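(* For every $\alpha>0$ and every $t\in\mathbb{R}$, $$ \int_0^\infty(\cos(tx)-1) \, \frac{\pi}{2}\, \frac{e^{-(\alpha-1)\pi|x|}\big(\alpha +(1-\alpha)e^{-\pi|x|}\big)}{\sinh^2(\pi|x|/2)}\,dx = \frac{2t}{\pi}\,\Re\big[i\,\Psi^{(0)}(it/\pi +\alpha)\big]. $$
   Context: $\Psi^{(0)}(z)=\frac{d}{dz}\log\Gamma(z)=\Gamma'(z)/\Gamma(z)$ is the digamma function and $\Re$ denotes the real part. (The identity is associated with the selfdecomposable logistic distribution with characteristic function $|\Gamma(\alpha+it/\pi)/\Gamma(\alpha)|^2$.) *)

theory Defs
  imports "HOL-Analysis.Analysis"
begin

(* The library introduces Digamma by a series; this confirms that it is the logarithmic
   derivative of Gamma away from the poles. *)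
lemma Digamma_eq_deriv_Gamma_over_Gamma:
  fixes z :: complex
  assumes "z \<notin> \<int>\<^sub>\<le>\<^sub>0"
  shows "Digamma z = deriv Gamma z / Gamma z"
proof -
  have "deriv Gamma z = Gamma z * Digamma z"
    using has_field_derivative_Gamma[OF assms] by (rule DERIV_imp_deriv)
  then show ?thesis
    using assms by (simp add: Gamma_eq_zero_iff)
qed

end

theory Submission
  imports Defs "HOL-Real_Asymp.Real_Asymp"
begin

text \<open>
  Put \<open>q = exp (- pi x)\<close>. Since \<open>sinh\<^sup>2 (pi x / 2) = (1 - q)\<^sup>2 / (4 q)\<close>, the non-oscillating
  factor of the integrand is \<open>2 pi q\<^sup>\<alpha> (\<alpha> + (1 - \<alpha>) q) / (1 - q)\<^sup>2\<close>. The expansion of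
  \<open>1 / (1 - q)\<^sup>2\<close> has coefficients \<open>n + 1\<close>, so multiplying it by \<open>\<alpha> + (1 - \<alpha>) q\<close> gives
  coefficients \<open>\<alpha> (n + 1) + (1 - \<alpha>) n = n + \<alpha>\<close> (lemma \<open>geometric_shifted_sums\<close>). The integrand is
  therefore a superposition of damped oscillations \<open>(cos (t x) - 1) exp (- a x)\<close> with rates
  \<open>a = pi (n + \<alpha>)\<close>, each of which has an elementary integral.

  All these terms have the same sign, so absolute convergence is the same as convergence of the
  resulting series of integrals, and termwise integration yields
  \<open>- 2 t\<^sup>2 \<Sum>n. 1 / (pi\<^sup>2 (n + \<alpha>)\<^sup>2 + t\<^sup>2)\<close>. On the other side,
  \<open>Re (\<i> * Digamma z) = - Im (Digamma z)\<close>, and in the limit formula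
  \<open>Digamma z = lim (ln m - \<Sum>n<m. 1 / (z + n))\<close> the divergent logarithm is real. Hence the
  imaginary part is a convergent series (lemma \<open>Im_Digamma_sums\<close>), and at
  \<open>z = \<alpha> + \<i> t / pi\<close>, multiplied by \<open>- 2 t / pi\<close>, it agrees term by term with the series of
  integrals.
\<close>

lemma geometric_shifted_sums:
  fixes q \<alpha> :: real
  assumes "\<bar>q\<bar> < 1"
  shows "(\<lambda>n. (real n + \<alpha>) * q ^ n) sums ((\<alpha> + (1 - \<alpha>) * q) / (1 - q)\<^sup>2)"
proof -
  have deriv: "(\<lambda>n. real (Suc n) * q ^ n) sums (1 / (1 - q)\<^sup>2)"
    using geometric_deriv_sums[of q] assms by simp
  have geom: "(\<lambda>n. q ^ n) sums (1 / (1 - q))"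
    using geometric_sums[of q] assms by simp
  have "(\<lambda>n. real (Suc n) * q ^ n + (\<alpha> - 1) * q ^ n) sums
          (1 / (1 - q)\<^sup>2 + (\<alpha> - 1) * (1 / (1 - q)))"
    by (intro sums_add sums_mult deriv geom)
  moreover have "1 / (1 - q)\<^sup>2 + (\<alpha> - 1) * (1 / (1 - q)) = (\<alpha> + (1 - \<alpha>) * q) / (1 - q)\<^sup>2"
  proof -
    have "1 / (1 - q) = (1 - q) / (1 - q)\<^sup>2"
      using assms by (simp add: power2_eq_square)
    then show ?thesis
      by (simp add: algebra_simps flip: add_divide_distrib diff_divide_distrib)
  qed
  moreover have "real (Suc n) * q ^ n + (\<alpha> - 1) * q ^ n = (real n + \<alpha>) * q ^ n" for n
    by (simp add: algebra_simps)
  ultimately show ?thesis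
    by simp
qed

lemma kernel_sums:
  fixes \<alpha> x :: real
  assumes "x > 0"
  shows "(\<lambda>n. 2 * pi * (real n + \<alpha>) * exp (- (pi * (real n + \<alpha>)) * x)) sums
           ((pi / 2) * (exp (- (\<alpha> - 1) * pi * x) * (\<alpha> + (1 - \<alpha>) * exp (- pi * x))
               / (sinh (pi * x / 2))\<^sup>2))"
proof -
  define q where "q = exp (- pi * x)"
  have q: "0 < q" "q < 1"
    using assms by (auto simp: q_def)
  have "4 * (sinh (pi * x / 2))\<^sup>2 = (exp (pi * x / 2) - exp (- (pi * x / 2)))\<^sup>2"
    by (simp add: sinh_def power2_eq_square)
  also have "\<dots> = exp (pi * x) - 2 + exp (- pi * x)"
    by (simp add: power2_eq_square algebra_simps flip: exp_add)
  also have "\<dots> = (1 - q)\<^sup>2 / q"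
    by (simp add: q_def exp_minus field_simps power2_eq_square)
  finally have sinh: "(sinh (pi * x / 2))\<^sup>2 = (1 - q)\<^sup>2 / (4 * q)"
    using q by (simp add: field_simps)
  have e: "exp (- (\<alpha> - 1) * pi * x) * q = exp (- (pi * \<alpha> * x))"
    unfolding q_def by (simp add: algebra_simps flip: exp_add)
  have "(\<lambda>n. 2 * pi * exp (- (pi * \<alpha> * x)) * ((real n + \<alpha>) * q ^ n)) sums
          (2 * pi * exp (- (pi * \<alpha> * x)) * ((\<alpha> + (1 - \<alpha>) * q) / (1 - q)\<^sup>2))"
    using q by (intro sums_mult geometric_shifted_sums) auto
  moreover have "2 * pi * exp (- (pi * \<alpha> * x)) * ((\<alpha> + (1 - \<alpha>) * q) / (1 - q)\<^sup>2)
      = (pi / 2) * (exp (- (\<alpha> - 1) * pi * x) * (\<alpha> + (1 - \<alpha>) * q) / (sinh (pi * x / 2))\<^sup>2)"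
    unfolding sinh e[symmetric] using q by (simp add: field_simps)
  moreover have "2 * pi * exp (- (pi * \<alpha> * x)) * ((real n + \<alpha>) * q ^ n)
      = 2 * pi * (real n + \<alpha>) * exp (- (pi * (real n + \<alpha>)) * x)" for n
  proof -
    have "exp (- (pi * (real n + \<alpha>)) * x) = exp (- (pi * \<alpha> * x)) * q ^ n"
      unfolding q_def by (simp add: algebra_simps flip: exp_add exp_of_nat_mult)
    then show ?thesis
      by simp
  qed
  ultimately show ?thesis
    by (simp only: q_def)
qed

text \<open>
  The half-line is taken closed so that the fundamental theorem of calculus applies; the integrand
  vanishes at \<open>0\<close>. Writing \<open>1 - cos\<close> makes the integrand nonnegative, so integrability comes from
  the same computation as the value.
\<close>
lemma has_bochner_integral_damped_one_minus_cos:
  fixes a t :: real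
  assumes "a > 0"
  shows "has_bochner_integral lborel (\<lambda>x. (1 - cos (t * x)) * exp (- a * x) * indicator {0..} x)
           (t\<^sup>2 / (a * (a\<^sup>2 + t\<^sup>2)))"
proof -
  define F where
    "F = (\<lambda>x. - (exp (- a * x) / a) + exp (- a * x) * (a * cos (t * x) - t * sin (t * x)) / (a\<^sup>2 + t\<^sup>2))"
  have pos: "a\<^sup>2 + t\<^sup>2 > 0"
    using assms by (simp add: add_pos_nonneg)
  have deriv: "DERIV F x :> (1 - cos (t * x)) * exp (- a * x)" for x
  proof -
    have "DERIV (\<lambda>x. exp (- a * x) * (a * cos (t * x) - t * sin (t * x))) x :>
            - (exp (- a * x) * cos (t * x)) * (a\<^sup>2 + t\<^sup>2)"
      by (auto intro!: derivative_eq_intros simp: algebra_simps power2_eq_square)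
    from DERIV_cdivide[OF this, of "a\<^sup>2 + t\<^sup>2"]
    have "DERIV (\<lambda>x. exp (- a * x) * (a * cos (t * x) - t * sin (t * x)) / (a\<^sup>2 + t\<^sup>2)) x :>
            - (exp (- a * x) * cos (t * x))"
      using assms by simp
    moreover have "DERIV (\<lambda>x. - (exp (- a * x) / a)) x :> exp (- a * x)"
      using assms by (auto intro!: derivative_eq_intros)
    ultimately have "DERIV F x :> exp (- a * x) + - (exp (- a * x) * cos (t * x))"
      unfolding F_def by (intro DERIV_add)
    then show ?thesis
      by (simp add: algebra_simps)
  qed
  have decay: "((\<lambda>x. exp (- a * x)) \<longlongrightarrow> 0) at_top"
    using assms by real_asymp
  have "((\<lambda>x. exp (- a * x) * (a * cos (t * x) - t * sin (t * x))) \<longlongrightarrow> 0) at_top"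
  proof (rule Lim_null_comparison)
    show "eventually (\<lambda>x. norm (exp (- a * x) * (a * cos (t * x) - t * sin (t * x)))
            \<le> exp (- a * x) * (\<bar>a\<bar> + \<bar>t\<bar>)) at_top"
    proof (intro always_eventually allI)
      fix x
      have "\<bar>a * cos (t * x) - t * sin (t * x)\<bar> \<le> \<bar>a * cos (t * x)\<bar> + \<bar>t * sin (t * x)\<bar>"
        by (rule abs_triangle_ineq4)
      also have "\<dots> \<le> \<bar>a\<bar> + \<bar>t\<bar>"
        by (intro add_mono) (auto simp: abs_mult intro: mult_left_le)
      finally show "norm (exp (- a * x) * (a * cos (t * x) - t * sin (t * x)))
            \<le> exp (- a * x) * (\<bar>a\<bar> + \<bar>t\<bar>)"
        by (simp add: abs_mult)
    qed
    show "((\<lambda>x. exp (- a * x) * (\<bar>a\<bar> + \<bar>t\<bar>)) \<longlongrightarrow> 0) at_top"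
      using tendsto_mult_right[OF decay, of "\<bar>a\<bar> + \<bar>t\<bar>"] by simp
  qed
  then have "(F \<longlongrightarrow> - (0 / a) + 0 / (a\<^sup>2 + t\<^sup>2)) at_top"
    unfolding F_def using assms pos decay by (intro tendsto_intros) auto
  then have lim: "(F \<longlongrightarrow> 0) at_top"
    by simp
  have "(\<integral>\<^sup>+x. ennreal ((1 - cos (t * x)) * exp (- a * x)) * indicator {0..} x \<partial>lborel)
          = ennreal (0 - F 0)"
    by (rule nn_integral_FTC_atLeast[OF _ deriv _ lim]) auto
  also have "0 - F 0 = t\<^sup>2 / (a * (a\<^sup>2 + t\<^sup>2))"
    using assms pos by (simp add: F_def field_simps power2_eq_square)
  finally have "(\<integral>\<^sup>+x. ennreal ((1 - cos (t * x)) * exp (- a * x) * indicator {0..} x) \<partial>lborel)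
          = ennreal (t\<^sup>2 / (a * (a\<^sup>2 + t\<^sup>2)))"
    by (subst (asm) nn_integral_cong[where v =
          "\<lambda>x. ennreal ((1 - cos (t * x)) * exp (- a * x) * indicator {0..} x)"])
       (auto simp: indicator_def)
  then show ?thesis
    using assms pos by (intro has_bochner_integral_nn_integral) auto
qed

text \<open>
  The logarithm in the limit formula for \<open>Digamma\<close>, which compensates the divergence of
  \<open>\<Sum>n. 1 / (z + n)\<close>, is real and thus invisible here.
\<close>
lemma Im_Digamma_sums:
  fixes z :: complex
  assumes "z \<noteq> 0"
  shows "(\<lambda>n. Im z / ((Re z + real n)\<^sup>2 + (Im z)\<^sup>2)) sums Im (Digamma z)"
proof -
  have "(\<lambda>m. Im (of_real (ln (real m)) - (\<Sum>n<m. inverse (z + of_nat n)))) \<longlonglongrightarrow> Im (Digamma z)"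
    by (intro tendsto_Im Digamma_LIMSEQ assms)
  then show ?thesis
    by (simp add: sums_def sum_negf[symmetric])
qed

theorem corollary3:
  fixes \<alpha> t :: real
  assumes "\<alpha> > 0"
  shows "set_integrable lborel {0<..}
           (\<lambda>x. (cos (t * x) - 1) * (pi / 2) *
             (exp (- (\<alpha> - 1) * pi * \<bar>x\<bar>) * (\<alpha> + (1 - \<alpha>) * exp (- pi * \<bar>x\<bar>))
               / (sinh (pi * \<bar>x\<bar> / 2))\<^sup>2)) \<and>
         (LINT x:{0<..}|lborel.
             (cos (t * x) - 1) * (pi / 2) *
             (exp (- (\<alpha> - 1) * pi * \<bar>x\<bar>) * (\<alpha> + (1 - \<alpha>) * exp (- pi * \<bar>x\<bar>))
               / (sinh (pi * \<bar>x\<bar> / 2))\<^sup>2))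
         = 2 * t / pi * Re (\<i> * Digamma (\<i> * complex_of_real t / complex_of_real pi + complex_of_real \<alpha>))"
proof -
  let ?g = "\<lambda>x. (cos (t * x) - 1) * (pi / 2) *
             (exp (- (\<alpha> - 1) * pi * \<bar>x\<bar>) * (\<alpha> + (1 - \<alpha>) * exp (- pi * \<bar>x\<bar>))
               / (sinh (pi * \<bar>x\<bar> / 2))\<^sup>2)"
  define z where "z = \<i> * complex_of_real t / complex_of_real pi + complex_of_real \<alpha>"
  define a where "a = (\<lambda>n::nat. pi * (real n + \<alpha>))"
  define f where "f = (\<lambda>n x. 2 * a n * ((1 - cos (t * x)) * exp (- a n * x) * indicator {0..} x))"
  define I where "I = (\<lambda>n. 2 * t\<^sup>2 / ((a n)\<^sup>2 + t\<^sup>2))"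
  have a: "a n > 0" for n
    using assms by (auto simp: a_def add_nonneg_pos)

  have f_int: "has_bochner_integral lborel (f n) (I n)" for n
  proof -
    have "has_bochner_integral lborel (f n) (2 * a n * (t\<^sup>2 / (a n * ((a n)\<^sup>2 + t\<^sup>2))))"
      unfolding f_def
      by (intro has_bochner_integral_mult_right has_bochner_integral_damped_one_minus_cos a)
    then show ?thesis
      using a[of n] by (simp add: I_def)
  qed
  have f_nonneg: "f n x \<ge> 0" for n x
    using a[of n] by (auto simp: f_def indicator_def)

  have z: "Re z = \<alpha>" "Im z = t / pi"
    by (simp_all add: z_def)
  then have "(\<lambda>n. 2 * t / pi * (Im z / ((Re z + real n)\<^sup>2 + (Im z)\<^sup>2))) sums (2 * t / pi * Im (Digamma z))"
    using assms by (intro sums_mult Im_Digamma_sums) auto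
  moreover have "2 * t / pi * (Im z / ((Re z + real n)\<^sup>2 + (Im z)\<^sup>2)) = I n" for n
  proof -
    have "(a n)\<^sup>2 + t\<^sup>2 = pi\<^sup>2 * ((\<alpha> + real n)\<^sup>2 + (t / pi)\<^sup>2)"
      by (simp add: a_def power_mult_distrib power_divide distrib_left[of "pi\<^sup>2"] add.commute)
    then show ?thesis
      by (simp add: I_def z power2_eq_square)
  qed
  ultimately have I_sums: "I sums (2 * t / pi * Im (Digamma z))"
    by simp

  have pointwise: "(\<lambda>n. f n x) sums (- (indicator {0<..} x * ?g x))" for x
  proof (cases "x > 0")
    case True
    have "(\<lambda>n. (1 - cos (t * x)) * (2 * pi * (real n + \<alpha>) * exp (- (pi * (real n + \<alpha>)) * x))) sums
      ((1 - cos (t * x)) * ((pi / 2) * (exp (- (\<alpha> - 1) * pi * x) * (\<alpha> + (1 - \<alpha>) * exp (- pi * x))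
               / (sinh (pi * x / 2))\<^sup>2)))"
      by (intro sums_mult kernel_sums True)
    moreover have "\<dots> = - (indicator {0<..} x * ?g x)"
      using True by (simp add: minus_diff_eq[of "cos (t * x)" 1, symmetric] del: minus_diff_eq)
    ultimately show ?thesis
      using True by (simp add: f_def a_def mult_ac)
  next
    case False
    \<comment> \<open>At \<open>x = 0\<close>, where the two indicators differ, the factor \<open>1 - cos\<close> vanishes.\<close>
    then have "f n x = 0" for n
      by (cases "x = 0") (auto simp: f_def)
    then show ?thesis
      using False by simp
  qed

  have summable_norm: "AE x in lborel. summable (\<lambda>n. norm (f n x))"
    using pointwise f_nonneg by (auto simp: sums_iff)
  have "(\<integral>x. norm (f n x) \<partial>lborel) = I n" for n
    using f_int[of n] f_nonneg by (simp add: has_bochner_integral_iff)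
  then have summable_int: "summable (\<lambda>n. \<integral>x. norm (f n x) \<partial>lborel)"
    using I_sums by (simp add: sums_iff)
  have f_integrable: "integrable lborel (f n)" for n
    using f_int by (simp add: has_bochner_integral_iff)
  note series = f_integrable summable_norm summable_int
  have suminf: "(\<lambda>x. \<Sum>n. f n x) = (\<lambda>x. - (indicator {0<..} x * ?g x))"
    using pointwise by (simp add: sums_iff)
  have "integrable lborel (\<lambda>x. - (indicator {0<..} x * ?g x))"
    using integrable_suminf[OF series] unfolding suminf .
  then have integrable: "integrable lborel (\<lambda>x. indicator {0<..} x * ?g x)"
    by simp
  have "(\<integral>x. - (indicator {0<..} x * ?g x) \<partial>lborel) = (\<Sum>n. I n)"
    using integral_suminf[OF series] f_int unfolding suminf by (simp add: has_bochner_integral_iff)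
  also have "\<dots> = 2 * t / pi * Im (Digamma z)"
    using I_sums by (simp add: sums_iff)
  finally have "(\<integral>x. indicator {0<..} x * ?g x \<partial>lborel) = 2 * t / pi * Re (\<i> * Digamma z)"
    by simp
  with integrable show ?thesis
    unfolding set_integrable_def set_lebesgue_integral_def z_def by simp
qed

end
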